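(* (Space Consumption.) Fix any CastHeight structure together with a cast constructor $\mathrm{coerce}(A,B,\ell):A\Rightarrow B$ defined for all consistent types $A\sim B$ and labels $\ell$. If $M$ is a GTLC term with $\Gamma\vdash_G M:A$, then there exists a natural number $c$ such that for every term $M':\Gamma\vdash A$ of $SC(\Rightarrow)$ with $\mathcal C[\![M]\!]\longrightarrow^{*}M'$ we have $$\mathsf{real\text{-}size}(M')\le c\cdot\mathsf{ideal\text{-}size}(M').$$
   Context: **Types.** Base types $b$: $\mathtt{Nat},\mathtt{Bool},\mathtt{Int},\mathtt{Unit},\bot$. Types: $A,B,C::=b\mid\,?\mid A\to B\mid A\times B\mid A+B$; $\otimes$ ranges over $\{\to,\times,+\}$. Contexts are finite sequences of types; variables are de Bruijn indices (index $0$ is the last-added type). Primitive types $P::=b\mid b\to P$; each $b$ denotes a set (naturals, Booleans, integers, one-element set, empty set), $[\![b\to P]\!]$ is the set of functions $[\![b]\!]\to[\![P]\!]$. Blame labels $\ell$ range over a fixed set. *Consistency* $\sim$: $A\sim\,?$; $?\sim B$; $b\sim b$; $A\otimes B\sim A'\otimes B'$ if $A\sim A'$, $B\sim B'$. *Join* of consistent types: $A\sqcup\,?=A$, $?\sqcup B=B$, $b\sqcup b=b$, $(A\otimes B)\sqcup(A'\otimes B')=(A\sqcup A')\otimes(B\sqcup B')$. *Matching*: $A\triangleright A_1\otimes A_2$ iff $A=A_1\otimes A_2$, or $A=A_1=A_2=\,?$. **GTLC** typing $\Gamma\vdash_G M:A$: $\$k:P$ for $k\in[\![P]\!]$; $`x:A$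 if $x$ has type $A$ in $\Gamma$; $\lambda[A]M:A\to B$ if $\Gamma\cdot A\vdash_G M:B$; $(L\,M)_\ell:A_2$ if $L:A$, $M:B$, $A\triangleright A_1\to A_2$, $A_1\sim B$; $\mathtt{if}_\ell\,L\,M\,N:B\sqcup C$ if $L:A$, $M:B$, $N:C$, $A\sim\mathtt{Bool}$, $B\sim C$; $\mathtt{cons}\,M\,N:A\times B$ if $M:A$, $N:B$; $\pi_i^\ell M:A_i$ if $M:A$, $A\triangleright A_1\times A_2$; $\mathtt{inl}[B]M:A+B$ if $M:A$; $\mathtt{inr}[A]M:A+B$ if $M:B$; $\mathtt{case}_\ell[B_1,C_1]\,L\,M\,N:B_2\sqcup C_2$ if $\Gamma\vdash_G L:A$, $\Gamma\cdot B_1\vdash_G M:B_2$, $\Gamma\cdot C_1\vdash_G N:C_2$, $A\sim B_1+C_1$, $B_2\sim C_2$. **PreCastStruct**: for all types $A,B$ a set $A\Rightarrow B$ of casts; predicates $\mathsf{Inert}$, $\mathsf{Active}$, $\mathsf{Cross}$ on casts; every cast is active or inert; every inert cast $c:A\Rightarrow(B\otimes C)$ is a cross cast and $A=A_1\otimes A_2$ for some $A_1,A_2$; no cast into a base type is inert; and operations taking a cast $c$ and a proof $x$ of $\mathsf{Cross}\,c$: for $c:(A_1\to A_2)\Rightarrow(B_1\to B_2)$, $\mathsf{dom}\,c\,x:B_1\Rightarrow A_1$ and $\mathsf{cod}\,c\,x:A_2\Rightarrow B_2$; for $c:(A_1\times A_2)\Rightarrow(B_1\times B_2)$, $\mathsf{fst}\,c\,x:A_1\Rightarrow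 B_1$ and $\mathsf{snd}\,c\,x:A_2\Rightarrow B_2$; for $c:(A_1+A_2)\Rightarrow(B_1+B_2)$, $\mathsf{inl}\,c\,x:A_1\Rightarrow B_1$ and $\mathsf{inr}\,c\,x:A_2\Rightarrow B_2$. A **ComposableCasts** structure adds: for each simple value $S:\Gamma\vdash A$, $c:A\Rightarrow B$, $a:\mathsf{Active}\,c$, a term $\mathsf{applyCast}\,S\,c\,a:\Gamma\vdash B$; and composition: $c:A\Rightarrow B$, $d:B\Rightarrow C$ give $c\ast d:A\Rightarrow C$. **Terms** of $SC(\Rightarrow)$ (intrinsically typed; $M:\Gamma\vdash A$): $\$k:P$; $`x:A$ if $x$ has type $A$ in $\Gamma$; $\lambda M:A\to B$ if $M:\Gamma\cdot A\vdash B$; $L\,M:B$ if $L:A\to B$, $M:A$; $\mathtt{if}\,L\,M\,N:B$ if $L:\mathtt{Bool}$, $M,N:B$; $\mathtt{cons}\,M\,N:A\times B$; $\pi_iM:A_i$ if $M:A_1\times A_2$; $\mathtt{inl}[B]M:A+B$ if $M:A$; $\mathtt{inr}[A]M:A+B$ if $M:B$; $\mathtt{case}\,L\,M\,N:B$ if $L:A_1+A_2$, $M:A_1\to B$, $N:A_2\to B$; $M\langle c\rangle:B$ if $M:A$, $c:A\Rightarrow B$; $\mathtt{blame}\,\ell:A$ for every $A$. **Simple values** $S$: $\lambda M$; $\$k$; $\mathtt{cons}\,V\,W$; $\mathtt{inl}[B]V$; $\mathtt{inr}[A]V$. **Values** $V,W$: $S$; $S\langle c\rangle$ with $c$ inert.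 **Frames** $F$: $\Box\,M$; $V\,\Box$; $\mathtt{if}\,\Box\,M\,N$; $\mathtt{cons}\,V\,\Box$; $\mathtt{cons}\,\Box\,N$; $\pi_i\Box$; $\mathtt{inl}[B]\Box$; $\mathtt{inr}[A]\Box$; $\mathtt{case}\,\Box\,M\,N$. **Reduction** $ctx\vdash M\longrightarrow N$, $ctx\in\{\mathtt{Any},\mathtt{NonCast}\}$ ($M[V]$ substitution for variable $0$; $\uparrow$ weakening): - $\mathtt{Any}\vdash F[M]\longrightarrow F[M']$ if $ctx\vdash M\longrightarrow M'$ for some $ctx$; $\mathtt{NonCast}\vdash M\langle c\rangle\longrightarrow M'\langle c\rangle$ if $\mathtt{Any}\vdash M\longrightarrow M'$. - $\mathtt{Any}\vdash F[\mathtt{blame}\,\ell]\longrightarrow\mathtt{blame}\,\ell$; $\mathtt{NonCast}\vdash(\mathtt{blame}\,\ell)\langle c\rangle\longrightarrow\mathtt{blame}\,\ell$. - $\mathtt{NonCast}\vdash S\langle c\rangle\longrightarrow\mathsf{applyCast}\,S\,c\,a$ for $a:\mathsf{Active}\,c$; $\mathtt{NonCast}\vdash M\langle c\rangle\langle d\rangle\longrightarrow M\langle c\ast d\rangle$. - With $ctx=\mathtt{Any}$, for $x:\mathsf{Cross}\,c$: $V\langle c\rangle\,W\longrightarrow(V\,(W\langle\mathsf{dom}\,c\,x\rangle))\langle\mathsf{cod}\,c\,x\rangle$; $\pi_1(V\langle c\rangle)\longrightarrow(\pi_1V)\langle\mathsf{fst}\,c\,x\rangle$; $\pi_2(V\langle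 c\rangle)\longrightarrow(\pi_2V)\langle\mathsf{snd}\,c\,x\rangle$; $\mathtt{case}\,(V\langle c\rangle)\,M\,N\longrightarrow\mathtt{case}\,V\,(\lambda((\uparrow M)\,(`0\langle\mathsf{inl}\,c\,x\rangle)))\,(\lambda((\uparrow N)\,(`0\langle\mathsf{inr}\,c\,x\rangle)))$. - With $ctx=\mathtt{Any}$: $(\lambda M)V\longrightarrow M[V]$; $\mathtt{if}\,\$\mathtt{true}\,M\,N\longrightarrow M$; $\mathtt{if}\,\$\mathtt{false}\,M\,N\longrightarrow N$; $\pi_1(\mathtt{cons}\,V\,W)\longrightarrow V$; $\pi_2(\mathtt{cons}\,V\,W)\longrightarrow W$; $\mathtt{case}(\mathtt{inl}[B]V)\,L\,M\longrightarrow L\,V$; $\mathtt{case}(\mathtt{inr}[A]V)\,L\,M\longrightarrow M\,V$; $\$k\,\$k'\longrightarrow\$(k(k'))$. $M\longrightarrow^{*}M'$ means a finite (possibly empty) sequence of steps, each of the form $ctx\vdash\cdot\longrightarrow\cdot$ for some $ctx$. **Compilation** $\mathcal C$ of well-typed GTLC terms (types as in the typing rules, $\langle A\Rightarrow^\ell B\rangle$ short for $\langle\mathrm{coerce}(A,B,\ell)\rangle$): $\$k\mapsto\$k$; $`x\mapsto`x$; $\lambda[A]M\mapsto\lambda\,\mathcal C[\![M]\!]$; $(L\,M)_\ell\mapsto\mathcal C[\![L]\!]\langle A\Rightarrow^\ell A_1\to A_2\rangle\;\mathcal C[\![M]\!]\langle B\Rightarrow^\ell A_1\rangle$; $\mathtt{if}_\ell\,L\,M\,N\mapsto\mathtt{if}\,(\mathcal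 C[\![L]\!]\langle A\Rightarrow^\ell\mathtt{Bool}\rangle)\,(\mathcal C[\![M]\!]\langle B\Rightarrow^\ell B\sqcup C\rangle)\,(\mathcal C[\![N]\!]\langle C\Rightarrow^\ell B\sqcup C\rangle)$; $\mathtt{cons},\mathtt{inl}[B],\mathtt{inr}[A]$ homomorphically; $\pi_i^\ell M\mapsto\pi_i(\mathcal C[\![M]\!]\langle A\Rightarrow^\ell A_1\times A_2\rangle)$; $\mathtt{case}_\ell[B_1,C_1]\,L\,M\,N\mapsto\mathtt{case}\,(\mathcal C[\![L]\!]\langle A\Rightarrow^\ell B_1+C_1\rangle)\,(\lambda\,\mathcal C[\![M]\!]\langle B_2\Rightarrow^\ell B_2\sqcup C_2\rangle)\,(\lambda\,\mathcal C[\![N]\!]\langle C_2\Rightarrow^\ell B_2\sqcup C_2\rangle)$. **Sizes of terms.** $\mathsf{ideal\text{-}size}(M\langle c\rangle)=\mathsf{ideal\text{-}size}(M)$ and $\mathsf{real\text{-}size}(M\langle c\rangle)=\mathsf{size}(c)+\mathsf{real\text{-}size}(M)$; for every other term constructor, both sizes are $1$ plus the sum of the corresponding sizes of the immediate subterms (so $1$ for variables, constants and blame). **Size predicate** $n\mid\beta\vdash M\ \mathrm{ok}$ ($n\in\mathbb N$, $\beta\in\{\mathit{true},\mathit{false}\}$), inductively: $n+1\mid\mathit{false}\vdash M\langle c\rangle$ ok if $n\mid\mathit{false}\vdash M$ ok and $n\le2$; $n+1\mid\mathit{true}\vdash M\langle c\rangle$ ok if $n\mid\mathit{true}\vdash M$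 ok and $n\le1$; $1\mid\beta\vdash`x$ ok; $0\mid\beta\vdash\$k$ ok; $0\mid\beta\vdash\mathtt{blame}\,\ell$ ok; $0\mid\beta\vdash\lambda N$ ok if $n\mid\mathit{true}\vdash N$ ok for some $n$; $0\mid\beta\vdash\mathtt{if}\,L\,M\,N$ ok and $0\mid\beta\vdash\mathtt{case}\,L\,M\,N$ ok if $n\mid\beta\vdash L$, $m\mid\mathit{true}\vdash M$, $k\mid\mathit{true}\vdash N$ ok for some $n,m,k$; for application, $\mathtt{cons}$, $\pi_i$, $\mathtt{inl}$, $\mathtt{inr}$: $0\mid\beta\vdash$ the term ok if each immediate subterm $M$ satisfies $n\mid\beta\vdash M$ ok for some $n$. **CastHeight structure**: a ComposableCasts structure with functions $\mathsf{height},\mathsf{size}$ from casts to $\mathbb N$ such that, writing $\mathsf{c\text{-}height}(M)$ for the maximum height of the casts occurring in a term $M$ ($0$ if none): - $\mathsf{height}(c\ast d)\le\max(\mathsf{height}(c),\mathsf{height}(d))$; - for a simple value $S$ and active $c$, if $n\mid\mathit{false}\vdash S$ ok then $m\mid\mathit{false}\vdash\mathsf{applyCast}\,S\,c\,a$ ok for some $m\le2+n$; - $\mathsf{c\text{-}height}(\mathsf{applyCast}\,S\,c\,a)\le\max(\mathsf{c\text{-}height}(S),\mathsf{height}(c))$; - for each cross cast $c$, the results of the applicable operations among $\mathsf{dom},\mathsf{cod},\mathsf{fst},\mathsf{snd},\mathsf{inl},\mathsf{inr}$ have height at most $\mathsf{height}(c)$; - there are constants $k_1,k_2\in\mathbb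 N$ with $\mathsf{size}(c)+k_1\le k_2\cdot2^{\mathsf{height}(c)}$ for every cast $c$. *)

theory Defs
  imports "HOL-Library.FuncSet"
begin

section \<open>Types\<close>

datatype base = TNat | TBool | TInt | TUnit | TBot

datatype tcon = Arrow | Times | Plus

datatype ty = Base base | Dyn | Con tcon ty ty

abbreviation FunT :: "ty \<Rightarrow> ty \<Rightarrow> ty" where "FunT \<equiv> Con Arrow"
abbreviation ProdT :: "ty \<Rightarrow> ty \<Rightarrow> ty" where "ProdT \<equiv> Con Times"
abbreviation SumT :: "ty \<Rightarrow> ty \<Rightarrow> ty" where "SumT \<equiv> Con Plus"

text \<open>De Bruijn index 0 is the head of the list, so the extension of \<open>\<Gamma>\<close> by \<open>A\<close> is \<open>A # \<Gamma>\<close>.\<close>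
type_synonym ctxt = "ty list"

inductive consistent :: "ty \<Rightarrow> ty \<Rightarrow> bool" where
  "consistent A Dyn"
| "consistent Dyn B"
| "consistent (Base b) (Base b)"
| "consistent A A' \<Longrightarrow> consistent B B' \<Longrightarrow> consistent (Con k A B) (Con k A' B')"

text \<open>Only meaningful on consistent types; on two distinct base types, or on types with different
  constructors, the value is irrelevant.\<close>
fun join :: "ty \<Rightarrow> ty \<Rightarrow> ty" where
  "join A Dyn = A"
| "join Dyn B = B"
| "join (Base b) (Base _) = Base b"
| "join (Con k A B) (Con _ A' B') = Con k (join A A') (join B B')"
| "join _ _ = undefined"

text \<open>\<open>matching k A = Some (A\<^sub>1, A\<^sub>2)\<close> is the matching relation between \<open>A\<close> and \<open>Con k A\<^sub>1 A\<^sub>2\<close>, which is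
  functional in \<open>A\<close> and \<open>k\<close>.\<close>
fun matching :: "tcon \<Rightarrow> ty \<Rightarrow> (ty \<times> ty) option" where
  "matching k (Con k' A\<^sub>1 A\<^sub>2) = (if k = k' then Some (A\<^sub>1, A\<^sub>2) else None)"
| "matching k Dyn = Some (Dyn, Dyn)"
| "matching k (Base b) = None"


section \<open>Primitive types and constants\<close>

datatype prim = PBase base | PArr base prim

primrec prim_ty :: "prim \<Rightarrow> ty" where
  "prim_ty (PBase b) = Base b"
| "prim_ty (PArr b P) = FunT (Base b) (prim_ty P)"

datatype lit = LNat nat | LBool bool | LInt int | LUnit

datatype pval = PLit lit | PFun "lit \<Rightarrow> pval"

primrec base_den :: "base \<Rightarrow> lit set" where
  "base_den TNat = range LNat"
| "base_den TBool = range LBool"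
| "base_den TInt = range LInt"
| "base_den TUnit = {LUnit}"
| "base_den TBot = {}"

text \<open>The extensional function space makes the elements of \<open>prim_den (PArr b P)\<close> correspond
  one-to-one to the set-theoretic functions from the denotation of \<open>b\<close> to that of \<open>P\<close>.\<close>
primrec prim_den :: "prim \<Rightarrow> pval set" where
  "prim_den (PBase b) = PLit ` base_den b"
| "prim_den (PArr b P) = PFun ` (base_den b \<rightarrow>\<^sub>E prim_den P)"


section \<open>The gradually typed lambda calculus\<close>

datatype 'l gterm =
    GConst prim pval
  | GVar nat
  | GLam ty "'l gterm"
  | GApp 'l "'l gterm" "'l gterm"
  | GIf 'l "'l gterm" "'l gterm" "'l gterm"
  | GCons "'l gterm" "'l gterm"
  | GFst 'l "'l gterm"
  | GSnd 'l "'l gterm"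
  | GInl ty "'l gterm"
  | GInr ty "'l gterm"
  | GCase 'l ty ty "'l gterm" "'l gterm" "'l gterm"

inductive gtyped :: "ctxt \<Rightarrow> 'l gterm \<Rightarrow> ty \<Rightarrow> bool" where
  "k \<in> prim_den P \<Longrightarrow> gtyped \<Gamma> (GConst P k) (prim_ty P)"
| "x < length \<Gamma> \<Longrightarrow> \<Gamma> ! x = A \<Longrightarrow> gtyped \<Gamma> (GVar x) A"
| "gtyped (A # \<Gamma>) M B \<Longrightarrow> gtyped \<Gamma> (GLam A M) (FunT A B)"
| "gtyped \<Gamma> L A \<Longrightarrow> gtyped \<Gamma> M B \<Longrightarrow> matching Arrow A = Some (A\<^sub>1, A\<^sub>2) \<Longrightarrow> consistent A\<^sub>1 B \<Longrightarrow>
    gtyped \<Gamma> (GApp l L M) A\<^sub>2"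
| "gtyped \<Gamma> L A \<Longrightarrow> gtyped \<Gamma> M B \<Longrightarrow> gtyped \<Gamma> N C \<Longrightarrow> consistent A (Base TBool) \<Longrightarrow> consistent B C \<Longrightarrow>
    gtyped \<Gamma> (GIf l L M N) (join B C)"
| "gtyped \<Gamma> M A \<Longrightarrow> gtyped \<Gamma> N B \<Longrightarrow> gtyped \<Gamma> (GCons M N) (ProdT A B)"
| "gtyped \<Gamma> M A \<Longrightarrow> matching Times A = Some (A\<^sub>1, A\<^sub>2) \<Longrightarrow> gtyped \<Gamma> (GFst l M) A\<^sub>1"
| "gtyped \<Gamma> M A \<Longrightarrow> matching Times A = Some (A\<^sub>1, A\<^sub>2) \<Longrightarrow> gtyped \<Gamma> (GSnd l M) A\<^sub>2"
| "gtyped \<Gamma> M A \<Longrightarrow> gtyped \<Gamma> (GInl B M) (SumT A B)"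
| "gtyped \<Gamma> M B \<Longrightarrow> gtyped \<Gamma> (GInr A M) (SumT A B)"
| "gtyped \<Gamma> L A \<Longrightarrow> gtyped (B\<^sub>1 # \<Gamma>) M B\<^sub>2 \<Longrightarrow> gtyped (C\<^sub>1 # \<Gamma>) N C\<^sub>2 \<Longrightarrow>
    consistent A (SumT B\<^sub>1 C\<^sub>1) \<Longrightarrow> consistent B\<^sub>2 C\<^sub>2 \<Longrightarrow>
    gtyped \<Gamma> (GCase l B\<^sub>1 C\<^sub>1 L M N) (join B\<^sub>2 C\<^sub>2)"

inductive_cases gtyped_elims:
  "gtyped \<Gamma> (GConst P k) A" "gtyped \<Gamma> (GVar x) A" "gtyped \<Gamma> (GLam B M) A"
  "gtyped \<Gamma> (GApp l L M) A" "gtyped \<Gamma> (GIf l L M N) A" "gtyped \<Gamma> (GCons M N) A"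
  "gtyped \<Gamma> (GFst l M) A" "gtyped \<Gamma> (GSnd l M) A" "gtyped \<Gamma> (GInl B M) A"
  "gtyped \<Gamma> (GInr B M) A" "gtyped \<Gamma> (GCase l B C L M N) A"

lemma gtyped_unique: "gtyped \<Gamma> M A \<Longrightarrow> gtyped \<Gamma> M B \<Longrightarrow> A = B"
proof (induction arbitrary: B rule: gtyped.induct)
  case (4 \<Gamma> L A M B' A\<^sub>1 A\<^sub>2 l)
  from "4.prems" obtain A' A\<^sub>1' where "gtyped \<Gamma> L A'" "matching Arrow A' = Some (A\<^sub>1', B)"
    by (auto elim: gtyped_elims)
  with "4.IH"(1) "4.hyps" show ?case by auto
next
  case (7 \<Gamma> M A A\<^sub>1 A\<^sub>2 l)
  from "7.prems" obtain A' A\<^sub>2' where "gtyped \<Gamma> M A'" "matching Times A' = Some (B, A\<^sub>2')"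
    by (auto elim: gtyped_elims)
  with "7.IH" "7.hyps" show ?case by auto
next
  case (8 \<Gamma> M A A\<^sub>1 A\<^sub>2 l)
  from "8.prems" obtain A' A\<^sub>1' where "gtyped \<Gamma> M A'" "matching Times A' = Some (A\<^sub>1', B)"
    by (auto elim: gtyped_elims)
  with "8.IH" "8.hyps" show ?case by auto
qed (blast elim: gtyped_elims)+

definition gty :: "ctxt \<Rightarrow> 'l gterm \<Rightarrow> ty" where
  "gty \<Gamma> M = (THE A. gtyped \<Gamma> M A)"

lemma gty_eq: "gtyped \<Gamma> M A \<Longrightarrow> gty \<Gamma> M = A"
  unfolding gty_def using gtyped_unique by blast


section \<open>Terms of the cast calculus\<close>

text \<open>The annotations on constants, abstractions and blame make the typing derivation of a term in a
  given context unique, so that the pairs of a term \<open>M\<close> with \<open>typed K \<Gamma> M A\<close> are the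
  intrinsically typed terms of type \<open>A\<close> in context \<open>\<Gamma>\<close>.\<close>
datatype ('c, 'l) trm =
    Const prim pval
  | Var nat
  | Lam ty "('c, 'l) trm"
  | App "('c, 'l) trm" "('c, 'l) trm"
  | Cond "('c, 'l) trm" "('c, 'l) trm" "('c, 'l) trm"
  | MkPair "('c, 'l) trm" "('c, 'l) trm"
  | Fst "('c, 'l) trm"
  | Snd "('c, 'l) trm"
  | InL ty "('c, 'l) trm"
  | InR ty "('c, 'l) trm"
  | Case "('c, 'l) trm" "('c, 'l) trm" "('c, 'l) trm"
  | Cast "('c, 'l) trm" 'c
  | Blame ty 'l

definition lift_ren :: "(nat \<Rightarrow> nat) \<Rightarrow> nat \<Rightarrow> nat" where
  "lift_ren \<rho> = case_nat 0 (\<lambda>x. Suc (\<rho> x))"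

primrec rename :: "('c, 'l) trm \<Rightarrow> (nat \<Rightarrow> nat) \<Rightarrow> ('c, 'l) trm" where
  "rename (Const P k) \<rho> = Const P k"
| "rename (Var x) \<rho> = Var (\<rho> x)"
| "rename (Lam A M) \<rho> = Lam A (rename M (lift_ren \<rho>))"
| "rename (App L M) \<rho> = App (rename L \<rho>) (rename M \<rho>)"
| "rename (Cond L M N) \<rho> = Cond (rename L \<rho>) (rename M \<rho>) (rename N \<rho>)"
| "rename (MkPair M N) \<rho> = MkPair (rename M \<rho>) (rename N \<rho>)"
| "rename (Fst M) \<rho> = Fst (rename M \<rho>)"
| "rename (Snd M) \<rho> = Snd (rename M \<rho>)"
| "rename (InL B M) \<rho> = InL B (rename M \<rho>)"
| "rename (InR A M) \<rho> = InR A (rename M \<rho>)"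
| "rename (Case L M N) \<rho> = Case (rename L \<rho>) (rename M \<rho>) (rename N \<rho>)"
| "rename (Cast M c) \<rho> = Cast (rename M \<rho>) c"
| "rename (Blame A l) \<rho> = Blame A l"

definition weaken :: "('c, 'l) trm \<Rightarrow> ('c, 'l) trm" where
  "weaken M = rename M Suc"

definition lift_sub :: "(nat \<Rightarrow> ('c, 'l) trm) \<Rightarrow> nat \<Rightarrow> ('c, 'l) trm" where
  "lift_sub \<sigma> = case_nat (Var 0) (\<lambda>x. weaken (\<sigma> x))"

primrec subst :: "('c, 'l) trm \<Rightarrow> (nat \<Rightarrow> ('c, 'l) trm) \<Rightarrow> ('c, 'l) trm" where
  "subst (Const P k) \<sigma> = Const P k"
| "subst (Var x) \<sigma> = \<sigma> x"
| "subst (Lam A M) \<sigma> = Lam A (subst M (lift_sub \<sigma>))"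
| "subst (App L M) \<sigma> = App (subst L \<sigma>) (subst M \<sigma>)"
| "subst (Cond L M N) \<sigma> = Cond (subst L \<sigma>) (subst M \<sigma>) (subst N \<sigma>)"
| "subst (MkPair M N) \<sigma> = MkPair (subst M \<sigma>) (subst N \<sigma>)"
| "subst (Fst M) \<sigma> = Fst (subst M \<sigma>)"
| "subst (Snd M) \<sigma> = Snd (subst M \<sigma>)"
| "subst (InL B M) \<sigma> = InL B (subst M \<sigma>)"
| "subst (InR A M) \<sigma> = InR A (subst M \<sigma>)"
| "subst (Case L M N) \<sigma> = Case (subst L \<sigma>) (subst M \<sigma>) (subst N \<sigma>)"
| "subst (Cast M c) \<sigma> = Cast (subst M \<sigma>) c"
| "subst (Blame A l) \<sigma> = Blame A l"

definition subst0 :: "('c, 'l) trm \<Rightarrow> ('c, 'l) trm \<Rightarrow> ('c, 'l) trm" where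
  "subst0 M V = subst M (case_nat V Var)"


section \<open>Cast structures\<close>

text \<open>The family of sets of casts is represented by one type \<open>'c\<close> with source and target maps: the
  casts from \<open>A\<close> to \<open>B\<close> are the \<open>c\<close> with \<open>is_cast K c A B\<close>.\<close>
record 'c pre_cast_struct =
  src :: "'c \<Rightarrow> ty"
  tgt :: "'c \<Rightarrow> ty"
  inert :: "'c \<Rightarrow> bool"
  active :: "'c \<Rightarrow> bool"
  cross :: "'c \<Rightarrow> bool"
  dom_cast :: "'c \<Rightarrow> 'c"
  cod_cast :: "'c \<Rightarrow> 'c"
  fst_cast :: "'c \<Rightarrow> 'c"
  snd_cast :: "'c \<Rightarrow> 'c"
  inl_cast :: "'c \<Rightarrow> 'c"
  inr_cast :: "'c \<Rightarrow> 'c"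

text \<open>\<open>apply_cast\<close> takes the context of the simple value as an argument, since it may depend on it.\<close>
record ('c, 'l) composable_casts = "'c pre_cast_struct" +
  apply_cast :: "ctxt \<Rightarrow> ('c, 'l) trm \<Rightarrow> 'c \<Rightarrow> ('c, 'l) trm"
  compose :: "'c \<Rightarrow> 'c \<Rightarrow> 'c"

record ('c, 'l) cast_height = "('c, 'l) composable_casts" +
  height :: "'c \<Rightarrow> nat"
  csize :: "'c \<Rightarrow> nat"

definition is_cast :: "('c, 'z) pre_cast_struct_scheme \<Rightarrow> 'c \<Rightarrow> ty \<Rightarrow> ty \<Rightarrow> bool" where
  "is_cast K c A B \<longleftrightarrow> src K c = A \<and> tgt K c = B"

inductive typed :: "('c, 'z) pre_cast_struct_scheme \<Rightarrow> ctxt \<Rightarrow> ('c, 'l) trm \<Rightarrow> ty \<Rightarrow> bool"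
  for K where
  "k \<in> prim_den P \<Longrightarrow> typed K \<Gamma> (Const P k) (prim_ty P)"
| "x < length \<Gamma> \<Longrightarrow> \<Gamma> ! x = A \<Longrightarrow> typed K \<Gamma> (Var x) A"
| "typed K (A # \<Gamma>) M B \<Longrightarrow> typed K \<Gamma> (Lam A M) (FunT A B)"
| "typed K \<Gamma> L (FunT A B) \<Longrightarrow> typed K \<Gamma> M A \<Longrightarrow> typed K \<Gamma> (App L M) B"
| "typed K \<Gamma> L (Base TBool) \<Longrightarrow> typed K \<Gamma> M B \<Longrightarrow> typed K \<Gamma> N B \<Longrightarrow> typed K \<Gamma> (Cond L M N) B"
| "typed K \<Gamma> M A \<Longrightarrow> typed K \<Gamma> N B \<Longrightarrow> typed K \<Gamma> (MkPair M N) (ProdT A B)"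
| "typed K \<Gamma> M (ProdT A B) \<Longrightarrow> typed K \<Gamma> (Fst M) A"
| "typed K \<Gamma> M (ProdT A B) \<Longrightarrow> typed K \<Gamma> (Snd M) B"
| "typed K \<Gamma> M A \<Longrightarrow> typed K \<Gamma> (InL B M) (SumT A B)"
| "typed K \<Gamma> M B \<Longrightarrow> typed K \<Gamma> (InR A M) (SumT A B)"
| "typed K \<Gamma> L (SumT A\<^sub>1 A\<^sub>2) \<Longrightarrow> typed K \<Gamma> M (FunT A\<^sub>1 B) \<Longrightarrow> typed K \<Gamma> N (FunT A\<^sub>2 B) \<Longrightarrow>
    typed K \<Gamma> (Case L M N) B"
| "typed K \<Gamma> M A \<Longrightarrow> is_cast K c A B \<Longrightarrow> typed K \<Gamma> (Cast M c) B"
| "typed K \<Gamma> (Blame A l) A"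

inductive simple_value :: "('c, 'z) pre_cast_struct_scheme \<Rightarrow> ('c, 'l) trm \<Rightarrow> bool"
  and is_value :: "('c, 'z) pre_cast_struct_scheme \<Rightarrow> ('c, 'l) trm \<Rightarrow> bool"
  for K where
  "simple_value K (Lam A M)"
| "simple_value K (Const P k)"
| "is_value K V \<Longrightarrow> is_value K W \<Longrightarrow> simple_value K (MkPair V W)"
| "is_value K V \<Longrightarrow> simple_value K (InL B V)"
| "is_value K V \<Longrightarrow> simple_value K (InR A V)"
| "simple_value K S \<Longrightarrow> is_value K S"
| "simple_value K S \<Longrightarrow> inert K c \<Longrightarrow> is_value K (Cast S c)"

inductive size_ok :: "nat \<Rightarrow> bool \<Rightarrow> ('c, 'l) trm \<Rightarrow> bool" where
  "size_ok n False M \<Longrightarrow> n \<le> 2 \<Longrightarrow> size_ok (n + 1) False (Cast M c)"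
| "size_ok n True M \<Longrightarrow> n \<le> 1 \<Longrightarrow> size_ok (n + 1) True (Cast M c)"
| "size_ok 1 \<beta> (Var x)"
| "size_ok 0 \<beta> (Const P k)"
| "size_ok 0 \<beta> (Blame A l)"
| "size_ok n True N \<Longrightarrow> size_ok 0 \<beta> (Lam A N)"
| "size_ok n \<beta> L \<Longrightarrow> size_ok m True M \<Longrightarrow> size_ok k True N \<Longrightarrow> size_ok 0 \<beta> (Cond L M N)"
| "size_ok n \<beta> L \<Longrightarrow> size_ok m True M \<Longrightarrow> size_ok k True N \<Longrightarrow> size_ok 0 \<beta> (Case L M N)"
| "size_ok n \<beta> L \<Longrightarrow> size_ok m \<beta> M \<Longrightarrow> size_ok 0 \<beta> (App L M)"
| "size_ok n \<beta> M \<Longrightarrow> size_ok m \<beta> N \<Longrightarrow> size_ok 0 \<beta> (MkPair M N)"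
| "size_ok n \<beta> M \<Longrightarrow> size_ok 0 \<beta> (Fst M)"
| "size_ok n \<beta> M \<Longrightarrow> size_ok 0 \<beta> (Snd M)"
| "size_ok n \<beta> M \<Longrightarrow> size_ok 0 \<beta> (InL B M)"
| "size_ok n \<beta> M \<Longrightarrow> size_ok 0 \<beta> (InR A M)"

primrec c_height :: "('c \<Rightarrow> nat) \<Rightarrow> ('c, 'l) trm \<Rightarrow> nat" where
  "c_height h (Const P k) = 0"
| "c_height h (Var x) = 0"
| "c_height h (Lam A M) = c_height h M"
| "c_height h (App L M) = max (c_height h L) (c_height h M)"
| "c_height h (Cond L M N) = max (c_height h L) (max (c_height h M) (c_height h N))"
| "c_height h (MkPair M N) = max (c_height h M) (c_height h N)"
| "c_height h (Fst M) = c_height h M"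
| "c_height h (Snd M) = c_height h M"
| "c_height h (InL B M) = c_height h M"
| "c_height h (InR A M) = c_height h M"
| "c_height h (Case L M N) = max (c_height h L) (max (c_height h M) (c_height h N))"
| "c_height h (Cast M c) = max (c_height h M) (h c)"
| "c_height h (Blame A l) = 0"

locale pre_cast_struct =
  fixes K :: "('c, 'z) pre_cast_struct_scheme"
  assumes active_or_inert: "active K c \<or> inert K c"
    and inert_cross: "is_cast K c A (Con k B C) \<Longrightarrow> inert K c \<Longrightarrow> cross K c \<and> (\<exists>A\<^sub>1 A\<^sub>2. A = Con k A\<^sub>1 A\<^sub>2)"
    and base_not_inert: "is_cast K c A (Base b) \<Longrightarrow> \<not> inert K c"
    and dom_cast: "is_cast K c (FunT A\<^sub>1 A\<^sub>2) (FunT B\<^sub>1 B\<^sub>2) \<Longrightarrow> cross K c \<Longrightarrow> is_cast K (dom_cast K c) B\<^sub>1 A\<^sub>1"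
    and cod_cast: "is_cast K c (FunT A\<^sub>1 A\<^sub>2) (FunT B\<^sub>1 B\<^sub>2) \<Longrightarrow> cross K c \<Longrightarrow> is_cast K (cod_cast K c) A\<^sub>2 B\<^sub>2"
    and fst_cast: "is_cast K c (ProdT A\<^sub>1 A\<^sub>2) (ProdT B\<^sub>1 B\<^sub>2) \<Longrightarrow> cross K c \<Longrightarrow> is_cast K (fst_cast K c) A\<^sub>1 B\<^sub>1"
    and snd_cast: "is_cast K c (ProdT A\<^sub>1 A\<^sub>2) (ProdT B\<^sub>1 B\<^sub>2) \<Longrightarrow> cross K c \<Longrightarrow> is_cast K (snd_cast K c) A\<^sub>2 B\<^sub>2"
    and inl_cast: "is_cast K c (SumT A\<^sub>1 A\<^sub>2) (SumT B\<^sub>1 B\<^sub>2) \<Longrightarrow> cross K c \<Longrightarrow> is_cast K (inl_cast K c) A\<^sub>1 B\<^sub>1"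
    and inr_cast: "is_cast K c (SumT A\<^sub>1 A\<^sub>2) (SumT B\<^sub>1 B\<^sub>2) \<Longrightarrow> cross K c \<Longrightarrow> is_cast K (inr_cast K c) A\<^sub>2 B\<^sub>2"

locale composable_casts = pre_cast_struct K
  for K :: "('c, 'l, 'z) composable_casts_scheme" +
  assumes apply_cast_typed:
      "typed K \<Gamma> S A \<Longrightarrow> simple_value K S \<Longrightarrow> is_cast K c A B \<Longrightarrow> active K c \<Longrightarrow>
        typed K \<Gamma> (apply_cast K \<Gamma> S c) B"
    and compose_cast: "is_cast K c A B \<Longrightarrow> is_cast K d B C \<Longrightarrow> is_cast K (compose K c d) A C"

locale cast_height = composable_casts K
  for K :: "('c, 'l, 'z) cast_height_scheme" +
  assumes height_compose:
      "is_cast K c A B \<Longrightarrow> is_cast K d B C \<Longrightarrow> height K (compose K c d) \<le> max (height K c) (height K d)"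
    and apply_cast_ok:
      "typed K \<Gamma> S A \<Longrightarrow> simple_value K S \<Longrightarrow> is_cast K c A B \<Longrightarrow> active K c \<Longrightarrow> size_ok n False S \<Longrightarrow>
        \<exists>m \<le> 2 + n. size_ok m False (apply_cast K \<Gamma> S c)"
    and apply_cast_height:
      "typed K \<Gamma> S A \<Longrightarrow> simple_value K S \<Longrightarrow> is_cast K c A B \<Longrightarrow> active K c \<Longrightarrow>
        c_height (height K) (apply_cast K \<Gamma> S c) \<le> max (c_height (height K) S) (height K c)"
    and height_dom_cod:
      "is_cast K c (FunT A\<^sub>1 A\<^sub>2) (FunT B\<^sub>1 B\<^sub>2) \<Longrightarrow> cross K c \<Longrightarrow>
        height K (dom_cast K c) \<le> height K c \<and> height K (cod_cast K c) \<le> height K c"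
    and height_fst_snd:
      "is_cast K c (ProdT A\<^sub>1 A\<^sub>2) (ProdT B\<^sub>1 B\<^sub>2) \<Longrightarrow> cross K c \<Longrightarrow>
        height K (fst_cast K c) \<le> height K c \<and> height K (snd_cast K c) \<le> height K c"
    and height_inl_inr:
      "is_cast K c (SumT A\<^sub>1 A\<^sub>2) (SumT B\<^sub>1 B\<^sub>2) \<Longrightarrow> cross K c \<Longrightarrow>
        height K (inl_cast K c) \<le> height K c \<and> height K (inr_cast K c) \<le> height K c"
    and size_height: "\<exists>k\<^sub>1 k\<^sub>2. \<forall>c. csize K c + k\<^sub>1 \<le> k\<^sub>2 * 2 ^ height K c"


section \<open>Reduction\<close>

datatype rctx = Any | NonCast

inductive is_frame ::
  "('c, 'z) pre_cast_struct_scheme \<Rightarrow> (('c, 'l) trm \<Rightarrow> ('c, 'l) trm) \<Rightarrow> bool"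
  for K where
  "is_frame K (\<lambda>X. App X M)"
| "is_value K V \<Longrightarrow> is_frame K (\<lambda>X. App V X)"
| "is_frame K (\<lambda>X. Cond X M N)"
| "is_value K V \<Longrightarrow> is_frame K (\<lambda>X. MkPair V X)"
| "is_frame K (\<lambda>X. MkPair X N)"
| "is_frame K (\<lambda>X. Fst X)"
| "is_frame K (\<lambda>X. Snd X)"
| "is_frame K (\<lambda>X. InL B X)"
| "is_frame K (\<lambda>X. InR A X)"
| "is_frame K (\<lambda>X. Case X M N)"

text \<open>Reduction of terms in the context \<open>\<Gamma>\<close>, which frames do not change. The typing premises are those
  needed to make sense of the right-hand sides, and hold automatically when the left-hand side is
  well typed.\<close>
inductive red ::
  "('c, 'l, 'z) composable_casts_scheme \<Rightarrow> ctxt \<Rightarrow> rctx \<Rightarrow> ('c, 'l) trm \<Rightarrow> ('c, 'l) trm \<Rightarrow> bool"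
  for K \<Gamma> where
  frame: "is_frame K F \<Longrightarrow> red K \<Gamma> ctx M M' \<Longrightarrow> red K \<Gamma> Any (F M) (F M')"
| cast_cong: "red K \<Gamma> Any M M' \<Longrightarrow> red K \<Gamma> NonCast (Cast M c) (Cast M' c)"
| frame_blame: "is_frame K F \<Longrightarrow> typed K \<Gamma> (F (Blame B l)) A \<Longrightarrow>
    red K \<Gamma> Any (F (Blame B l)) (Blame A l)"
| cast_blame: "is_cast K c A B \<Longrightarrow> red K \<Gamma> NonCast (Cast (Blame A l) c) (Blame B l)"
| apply_active: "typed K \<Gamma> S A \<Longrightarrow> simple_value K S \<Longrightarrow> is_cast K c A B \<Longrightarrow> active K c \<Longrightarrow>
    red K \<Gamma> NonCast (Cast S c) (apply_cast K \<Gamma> S c)"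
| compose: "is_cast K c A B \<Longrightarrow> is_cast K d B C \<Longrightarrow>
    red K \<Gamma> NonCast (Cast (Cast M c) d) (Cast M (compose K c d))"
| fun_cast: "is_value K V \<Longrightarrow> is_value K W \<Longrightarrow> is_cast K c (FunT A\<^sub>1 A\<^sub>2) (FunT B\<^sub>1 B\<^sub>2) \<Longrightarrow> cross K c \<Longrightarrow>
    red K \<Gamma> Any (App (Cast V c) W) (Cast (App V (Cast W (dom_cast K c))) (cod_cast K c))"
| fst_cast: "is_value K V \<Longrightarrow> is_cast K c (ProdT A\<^sub>1 A\<^sub>2) (ProdT B\<^sub>1 B\<^sub>2) \<Longrightarrow> cross K c \<Longrightarrow>
    red K \<Gamma> Any (Fst (Cast V c)) (Cast (Fst V) (fst_cast K c))"
| snd_cast: "is_value K V \<Longrightarrow> is_cast K c (ProdT A\<^sub>1 A\<^sub>2) (ProdT B\<^sub>1 B\<^sub>2) \<Longrightarrow> cross K c \<Longrightarrow>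
    red K \<Gamma> Any (Snd (Cast V c)) (Cast (Snd V) (snd_cast K c))"
| case_cast: "is_value K V \<Longrightarrow> is_cast K c (SumT A\<^sub>1 A\<^sub>2) (SumT B\<^sub>1 B\<^sub>2) \<Longrightarrow> cross K c \<Longrightarrow>
    red K \<Gamma> Any (Case (Cast V c) M N)
      (Case V (Lam A\<^sub>1 (App (weaken M) (Cast (Var 0) (inl_cast K c))))
              (Lam A\<^sub>2 (App (weaken N) (Cast (Var 0) (inr_cast K c)))))"
| beta: "is_value K V \<Longrightarrow> red K \<Gamma> Any (App (Lam A M) V) (subst0 M V)"
| if_true: "red K \<Gamma> Any (Cond (Const (PBase TBool) (PLit (LBool True))) M N) M"
| if_false: "red K \<Gamma> Any (Cond (Const (PBase TBool) (PLit (LBool False))) M N) N"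
| fst_pair: "is_value K V \<Longrightarrow> is_value K W \<Longrightarrow> red K \<Gamma> Any (Fst (MkPair V W)) V"
| snd_pair: "is_value K V \<Longrightarrow> is_value K W \<Longrightarrow> red K \<Gamma> Any (Snd (MkPair V W)) W"
| case_inl: "is_value K V \<Longrightarrow> red K \<Gamma> Any (Case (InL B V) L M) (App L V)"
| case_inr: "is_value K V \<Longrightarrow> red K \<Gamma> Any (Case (InR A V) L M) (App M V)"
| delta: "red K \<Gamma> Any (App (Const (PArr b P) (PFun f)) (Const (PBase b) (PLit v))) (Const P (f v))"

definition steps ::
  "('c, 'l, 'z) composable_casts_scheme \<Rightarrow> ctxt \<Rightarrow> ('c, 'l) trm \<Rightarrow> ('c, 'l) trm \<Rightarrow> bool" where
  "steps K \<Gamma> = (\<lambda>M N. \<exists>ctx. red K \<Gamma> ctx M N)\<^sup>*\<^sup>*"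


section \<open>Compilation\<close>

text \<open>Compilation of terms well typed in \<open>\<Gamma>\<close>; the types that a typing derivation assigns to the
  subterms are recovered by \<open>gty\<close>, as they are unique.\<close>
primrec compile :: "(ty \<Rightarrow> ty \<Rightarrow> 'l \<Rightarrow> 'c) \<Rightarrow> ctxt \<Rightarrow> 'l gterm \<Rightarrow> ('c, 'l) trm" where
  "compile coerce \<Gamma> (GConst P k) = Const P k"
| "compile coerce \<Gamma> (GVar x) = Var x"
| "compile coerce \<Gamma> (GLam A M) = Lam A (compile coerce (A # \<Gamma>) M)"
| "compile coerce \<Gamma> (GApp l L M) =
    (let A = gty \<Gamma> L; B = gty \<Gamma> M; (A\<^sub>1, A\<^sub>2) = the (matching Arrow A) in
      App (Cast (compile coerce \<Gamma> L) (coerce A (FunT A\<^sub>1 A\<^sub>2) l))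
          (Cast (compile coerce \<Gamma> M) (coerce B A\<^sub>1 l)))"
| "compile coerce \<Gamma> (GIf l L M N) =
    (let A = gty \<Gamma> L; B = gty \<Gamma> M; C = gty \<Gamma> N in
      Cond (Cast (compile coerce \<Gamma> L) (coerce A (Base TBool) l))
           (Cast (compile coerce \<Gamma> M) (coerce B (join B C) l))
           (Cast (compile coerce \<Gamma> N) (coerce C (join B C) l)))"
| "compile coerce \<Gamma> (GCons M N) = MkPair (compile coerce \<Gamma> M) (compile coerce \<Gamma> N)"
| "compile coerce \<Gamma> (GFst l M) =
    (let A = gty \<Gamma> M; (A\<^sub>1, A\<^sub>2) = the (matching Times A) in
      Fst (Cast (compile coerce \<Gamma> M) (coerce A (ProdT A\<^sub>1 A\<^sub>2) l)))"
| "compile coerce \<Gamma> (GSnd l M) =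
    (let A = gty \<Gamma> M; (A\<^sub>1, A\<^sub>2) = the (matching Times A) in
      Snd (Cast (compile coerce \<Gamma> M) (coerce A (ProdT A\<^sub>1 A\<^sub>2) l)))"
| "compile coerce \<Gamma> (GInl B M) = InL B (compile coerce \<Gamma> M)"
| "compile coerce \<Gamma> (GInr A M) = InR A (compile coerce \<Gamma> M)"
| "compile coerce \<Gamma> (GCase l B\<^sub>1 C\<^sub>1 L M N) =
    (let A = gty \<Gamma> L; B\<^sub>2 = gty (B\<^sub>1 # \<Gamma>) M; C\<^sub>2 = gty (C\<^sub>1 # \<Gamma>) N in
      Case (Cast (compile coerce \<Gamma> L) (coerce A (SumT B\<^sub>1 C\<^sub>1) l))
           (Lam B\<^sub>1 (Cast (compile coerce (B\<^sub>1 # \<Gamma>) M) (coerce B\<^sub>2 (join B\<^sub>2 C\<^sub>2) l)))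
           (Lam C\<^sub>1 (Cast (compile coerce (C\<^sub>1 # \<Gamma>) N) (coerce C\<^sub>2 (join B\<^sub>2 C\<^sub>2) l))))"


section \<open>Sizes\<close>

primrec ideal_size :: "('c, 'l) trm \<Rightarrow> nat" where
  "ideal_size (Const P k) = 1"
| "ideal_size (Var x) = 1"
| "ideal_size (Lam A M) = 1 + ideal_size M"
| "ideal_size (App L M) = 1 + ideal_size L + ideal_size M"
| "ideal_size (Cond L M N) = 1 + ideal_size L + ideal_size M + ideal_size N"
| "ideal_size (MkPair M N) = 1 + ideal_size M + ideal_size N"
| "ideal_size (Fst M) = 1 + ideal_size M"
| "ideal_size (Snd M) = 1 + ideal_size M"
| "ideal_size (InL B M) = 1 + ideal_size M"
| "ideal_size (InR A M) = 1 + ideal_size M"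
| "ideal_size (Case L M N) = 1 + ideal_size L + ideal_size M + ideal_size N"
| "ideal_size (Cast M c) = ideal_size M"
| "ideal_size (Blame A l) = 1"

primrec real_size :: "('c \<Rightarrow> nat) \<Rightarrow> ('c, 'l) trm \<Rightarrow> nat" where
  "real_size s (Const P k) = 1"
| "real_size s (Var x) = 1"
| "real_size s (Lam A M) = 1 + real_size s M"
| "real_size s (App L M) = 1 + real_size s L + real_size s M"
| "real_size s (Cond L M N) = 1 + real_size s L + real_size s M + real_size s N"
| "real_size s (MkPair M N) = 1 + real_size s M + real_size s N"
| "real_size s (Fst M) = 1 + real_size s M"
| "real_size s (Snd M) = 1 + real_size s M"
| "real_size s (InL B M) = 1 + real_size s M"
| "real_size s (InR A M) = 1 + real_size s M"
| "real_size s (Case L M N) = 1 + real_size s L + real_size s M + real_size s N"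
| "real_size s (Cast M c) = s c + real_size s M"
| "real_size s (Blame A l) = 1"

end

theory Submission
  imports Defs
begin

text \<open>Reduction preserves the size predicate at flag \<open>False\<close> and does not increase the height of
  casts. The predicate allows at most three casts on top of any other constructor, and the height
  bounds the size of each cast by a constant fixed by the compiled term. The bound of three survives
  \<open>cast_cong\<close> because a reduction with context \<open>Any\<close> never starts from a cast, and leaves at most two
  casts on top of its result: branches and bodies of abstractions are checked with flag \<open>True\<close>,
  and a value carries at most one cast.\<close>

section \<open>Bounds and flags of the size predicate\<close>

inductive_cases size_ok_elims [elim!]:
  "size_ok n \<beta> (Const P k)" "size_ok n \<beta> (Var x)" "size_ok n \<beta> (Lam A M)"
  "size_ok n \<beta> (App L M)" "size_ok n \<beta> (Cond L M N)" "size_ok n \<beta> (MkPair M N)"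
  "size_ok n \<beta> (Fst M)" "size_ok n \<beta> (Snd M)" "size_ok n \<beta> (InL A M)"
  "size_ok n \<beta> (InR A M)" "size_ok n \<beta> (Case L M N)" "size_ok n \<beta> (Blame A l)"

inductive_cases size_ok_CastE: "size_ok n \<beta> (Cast M c)"

lemma size_ok_Var: "size_ok (Suc 0) \<beta> (Var x)"
  using size_ok.intros(3) by simp

lemma size_ok_Cast_False: "size_ok n False M \<Longrightarrow> n \<le> 2 \<Longrightarrow> size_ok (Suc n) False (Cast M c)"
  using size_ok.intros(1) by fastforce

text \<open>The bound \<open>1\<close> is the stricter of the two cast rules, so one statement
  serves both flags.\<close>

lemma size_ok_Cast: "size_ok n \<beta> M \<Longrightarrow> n \<le> 1 \<Longrightarrow> size_ok (Suc n) \<beta> (Cast M c)"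
  by (cases \<beta>) (use size_ok.intros(1,2) in fastforce)+

lemma size_ok_CastD: "size_ok n \<beta> (Cast M c) \<Longrightarrow> \<exists>m. n = Suc m \<and> size_ok m \<beta> M"
  by (auto elim: size_ok_CastE)

lemma size_ok_bound: "size_ok n \<beta> M \<Longrightarrow> n \<le> (if \<beta> then 2 else 3)"
  by (induction rule: size_ok.induct) auto

text \<open>For branches checked at \<open>True\<close> that surface at \<open>False\<close> once
  selected: the cast rule at \<open>False\<close> has the looser bound.\<close>

lemma size_ok_weaken_flag: "size_ok n \<beta> M \<Longrightarrow> size_ok n False M"
  by (induction rule: size_ok.induct)
    (auto intro: size_ok.intros size_ok_Var size_ok_Cast_False)

text \<open>A simple value counts \<open>0\<close> and an inert cast adds one, which fits either
  flag, recursively in pairs and injections; bodies of abstractions are checked at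
  \<open>True\<close> in any case.\<close>

lemma
  fixes S V :: "('c, 'l) trm"
  shows simple_value_size_ok:
      "simple_value K S \<Longrightarrow> size_ok n \<beta> S \<Longrightarrow> n = 0 \<and> size_ok 0 \<beta>' S"
    and value_size_ok: "is_value K V \<Longrightarrow> size_ok n \<beta> V \<Longrightarrow> n \<le> 1 \<and> size_ok n \<beta>' V"
proof (induction arbitrary: n \<beta> and n \<beta> rule: simple_value_is_value.inducts)
  case (7 S c)
  then show ?case by (fastforce dest: size_ok_CastD intro: size_ok_Cast)
qed (blast intro: size_ok.intros)+

section \<open>Renaming and substitution\<close>

lemma size_ok_rename: "size_ok n \<beta> M \<Longrightarrow> size_ok n \<beta> (rename M \<rho>)"
  by (induction arbitrary: \<rho> rule: size_ok.induct) (auto intro: size_ok.intros simp del: One_nat_def)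

text \<open>A variable counts as one cast, leaving room for the cast on top of a substituted value.\<close>
lemma size_ok_subst:
  "size_ok n \<beta> M \<Longrightarrow> (\<And>x. \<exists>m \<le> 1. \<forall>\<beta>. size_ok m \<beta> (\<sigma> x)) \<Longrightarrow> \<exists>m \<le> n. size_ok m \<beta> (subst M \<sigma>)"
proof (induction arbitrary: \<sigma> rule: size_ok.induct)
  case (1 n M c)
  then obtain m where "m \<le> n" "size_ok m False (subst M \<sigma>)" by blast
  with 1 show ?case by (intro exI[of _ "Suc m"]) (auto intro: size_ok_Cast_False)
next
  case (2 n M c)
  then obtain m where "m \<le> n" "size_ok m True (subst M \<sigma>)" by blast
  with 2 show ?case by (intro exI[of _ "Suc m"]) (auto intro: size_ok_Cast)
next
  case (6 n N \<beta> A)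
  have "\<exists>m \<le> 1. \<forall>\<beta>. size_ok m \<beta> (lift_sub \<sigma> x)" for x
  proof (cases x)
    case 0
    then show ?thesis by (auto simp: lift_sub_def intro: size_ok_Var)
  next
    case (Suc y)
    with "6.prems"[of y] show ?thesis by (auto simp: lift_sub_def weaken_def intro: size_ok_rename)
  qed
  with "6.IH" obtain m where "size_ok m True (subst N (lift_sub \<sigma>))" by blast
  then show ?case by (auto intro: size_ok.intros)
next
  case (7 n \<beta> L m M k N)
  then show ?case unfolding subst.simps by (meson size_ok.intros(7) order_refl)
next
  case (8 n \<beta> L m M k N)
  then show ?case unfolding subst.simps by (meson size_ok.intros(8) order_refl)
next
  case (9 n \<beta> L m M)
  then show ?case unfolding subst.simps by (meson size_ok.intros(9) order_refl)
next
  case (10 n \<beta> M m N)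
  then show ?case unfolding subst.simps by (meson size_ok.intros(10) order_refl)
next
  case (11 n \<beta> M)
  then show ?case unfolding subst.simps by (meson size_ok.intros(11) order_refl)
next
  case (12 n \<beta> M)
  then show ?case unfolding subst.simps by (meson size_ok.intros(12) order_refl)
next
  case (13 n \<beta> M B)
  then show ?case unfolding subst.simps by (meson size_ok.intros(13) order_refl)
next
  case (14 n \<beta> M A)
  then show ?case unfolding subst.simps by (meson size_ok.intros(14) order_refl)
qed (auto intro: size_ok.intros)

text \<open>The body, checked at \<open>True\<close>, counts at most \<open>2\<close>, and
  substitution does not raise this. Being a value, the argument is acceptable at every flag.\<close>

lemma size_ok_subst0:
  assumes "size_ok n True M" "is_value K V" "size_ok m \<beta> V"
  shows "\<exists>k \<le> 2. size_ok k \<beta>' (subst0 M V)"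
proof -
  have "\<exists>m \<le> 1. \<forall>\<beta>. size_ok m \<beta> (case_nat V Var x)" for x
  proof (cases x)
    case 0
    with value_size_ok[OF assms(2,3)] show ?thesis by auto
  next
    case (Suc y)
    then show ?thesis by (auto intro: size_ok_Var)
  qed
  from size_ok_subst[OF assms(1), of "case_nat V Var", OF this]
  obtain k where k: "k \<le> n" "size_ok k True (subst0 M V)" by (auto simp: subst0_def)
  moreover have "k \<le> 2" using size_ok_bound[OF k(2)] by simp
  ultimately show ?thesis using size_ok_weaken_flag by (cases \<beta>') auto
qed

section \<open>Preservation of the size predicate\<close>

text \<open>The hole is never a branch or a body, so it keeps the flag; the constructor around it
  resets the count.\<close>

lemma size_ok_frame:
  assumes "is_frame K F" "size_ok n \<beta> (F M)"
  shows "n = 0 \<and> (\<exists>m. size_ok m \<beta> M) \<and> (\<forall>m M'. size_ok m \<beta> M' \<longrightarrow> size_ok 0 \<beta> (F M'))"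
  using assms by cases (auto intro: size_ok.intros)

text \<open>The variable counts \<open>1\<close> and its cast makes \<open>2\<close>, the most that
  \<open>True\<close> permits.\<close>

lemma size_ok_case_branch:
  assumes "size_ok n True M"
  shows "size_ok 0 \<beta> (Lam A (App (weaken M) (Cast (Var 0) c)))"
proof -
  have "size_ok (Suc (Suc 0)) True (Cast (Var 0) c)"
    by (rule size_ok_Cast) (rule size_ok_Var, simp)
  from size_ok.intros(9)[OF size_ok_rename[OF assms] this] show ?thesis
    unfolding weaken_def by (rule size_ok.intros(6))
qed

text \<open>The bound for \<open>Any\<close> leaves room for the cast that \<open>cast_cong\<close>
  puts on the reduct. Inside a larger term, a \<open>NonCast\<close> step happens directly in a
  frame, where every count is accepted.\<close>

lemma (in cast_height) size_ok_red:
  assumes "red K \<Gamma> ctx M M'" "size_ok n False M"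
  shows "\<exists>m. size_ok m False M' \<and> (ctx = Any \<longrightarrow> m \<le> 2)"
  using assms
proof (induction arbitrary: n rule: red.induct)
  case (frame F ctx M M')
  then show ?case using size_ok_frame by blast
next
  case (cast_cong M M' c)
  then obtain k where "size_ok k False M" by (auto dest: size_ok_CastD)
  then obtain m where "size_ok m False M'" "m \<le> 2" using cast_cong.IH by blast
  then show ?case by (auto intro: size_ok_Cast_False)
next
  case (apply_active S A c B)
  then obtain m where "size_ok m False S" by (auto dest: size_ok_CastD)
  with apply_active show ?case using apply_cast_ok by blast
next
  case (compose c A B d C M)
  then obtain m where m: "size_ok m False M" "n = Suc (Suc m)" by (auto dest!: size_ok_CastD)
  \<comment> \<open>Two of at most three stacked casts are merged, so the composite fits.\<close>
  then have "m \<le> 2" using size_ok_bound[OF compose.prems] by simp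
  with m show ?case by (auto intro: size_ok_Cast_False)
next
  case (fun_cast V W c A\<^sub>1 A\<^sub>2 B\<^sub>1 B\<^sub>2)
  then obtain m k where V: "size_ok m False V" and W: "size_ok k False W"
    by (auto dest: size_ok_CastD)
  \<comment> \<open>As a value, \<open>W\<close> carries at most one cast, which leaves room for
    \<open>dom_cast\<close>.\<close>
  have "size_ok (Suc k) False (Cast W (dom_cast K c))"
    using W value_size_ok[OF fun_cast.hyps(2) W] by (auto intro: size_ok_Cast)
  with V have "size_ok 0 False (App V (Cast W (dom_cast K c)))" by (rule size_ok.intros)
  then have "size_ok (Suc 0) False (Cast (App V (Cast W (dom_cast K c))) (cod_cast K c))"
    by (rule size_ok_Cast) simp
  then show ?case by auto
next
  case (fst_cast V c A\<^sub>1 A\<^sub>2 B\<^sub>1 B\<^sub>2)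
  then have "size_ok 0 False (Fst V)" by (auto dest: size_ok_CastD intro: size_ok.intros)
  then have "size_ok (Suc 0) False (Cast (Fst V) (fst_cast K c))" by (rule size_ok_Cast) simp
  then show ?case by auto
next
  case (snd_cast V c A\<^sub>1 A\<^sub>2 B\<^sub>1 B\<^sub>2)
  then have "size_ok 0 False (Snd V)" by (auto dest: size_ok_CastD intro: size_ok.intros)
  then have "size_ok (Suc 0) False (Cast (Snd V) (snd_cast K c))" by (rule size_ok_Cast) simp
  then show ?case by auto
next
  case (case_cast V c A\<^sub>1 A\<^sub>2 B\<^sub>1 B\<^sub>2 M N)
  then obtain m k j where ok: "size_ok m False V" "size_ok k True M" "size_ok j True N"
    by (auto dest: size_ok_CastD)
  show ?case using size_ok.intros(8)[OF ok(1) size_ok_case_branch[OF ok(2)] size_ok_case_branch[OF ok(3)]] by blast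
next
  case (beta V A M)
  then obtain k m where "size_ok k True M" "size_ok m False V" by auto
  from size_ok_subst0[OF this(1) beta.hyps this(2)] show ?case by blast
next
  case (if_true M N)
  then obtain k where "size_ok k True M" by auto
  then show ?case using size_ok_weaken_flag size_ok_bound[of k True M] by auto
next
  case (if_false M N)
  then obtain k where "size_ok k True N" by auto
  then show ?case using size_ok_weaken_flag size_ok_bound[of k True N] by auto
next
  case (fst_pair V W)
  then obtain k where "size_ok k False V" by auto
  \<comment> \<open>The predicate alone would allow three casts on \<open>V\<close>; a value has at
    most one, within the bound for \<open>Any\<close>.\<close>
  with value_size_ok[OF fst_pair.hyps(1) this] show ?case by force
next
  case (snd_pair V W)
  then obtain k where "size_ok k False W" by auto
  with value_size_ok[OF snd_pair.hyps(2) this] show ?case by force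
next
  case (case_inl V B L M)
  then show ?case by (blast intro: size_ok.intros size_ok_weaken_flag)
next
  case (case_inr V A L M)
  then show ?case by (blast intro: size_ok.intros size_ok_weaken_flag)
qed (blast intro: size_ok.intros)+

section \<open>Cast heights under reduction\<close>

lemma c_height_rename [simp]: "c_height h (rename M \<rho>) = c_height h M"
  by (induction M arbitrary: \<rho>) auto

text \<open>A common bound \<open>b\<close> stands in for a maximum over the infinitely many entries
  of \<open>\<sigma>\<close>.\<close>

lemma c_height_subst:
  "c_height h M \<le> b \<Longrightarrow> (\<And>x. c_height h (\<sigma> x) \<le> b) \<Longrightarrow> c_height h (subst M \<sigma>) \<le> b"
proof (induction M arbitrary: \<sigma>)
  case (Lam A M)
  have "c_height h (lift_sub \<sigma> x) \<le> b" for x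
    using Lam.prems by (cases x) (auto simp: lift_sub_def weaken_def)
  then show ?case using Lam by simp
qed simp_all

lemma c_height_subst0: "c_height h (subst0 M V) \<le> max (c_height h M) (c_height h V)"
  unfolding subst0_def by (rule c_height_subst) (auto split: nat.split)

lemma c_height_frame:
  assumes "is_frame K F" "c_height h M' \<le> c_height h M"
  shows "c_height h (F M') \<le> c_height h (F M)"
  using assms by cases auto

text \<open>Every cast of the reduct is inherited or comes from \<open>compose\<close>,
  \<open>apply_cast\<close> or a component of a cross cast, whose heights the structure
  bounds.\<close>

lemma (in cast_height) c_height_red:
  "red K \<Gamma> ctx M M' \<Longrightarrow> c_height (height K) M' \<le> c_height (height K) M"
proof (induction rule: red.induct)
  case (frame F ctx M M')
  then show ?case by (simp add: c_height_frame)
next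
  case (apply_active S A c B)
  then show ?case using apply_cast_height by simp
next
  case (compose c A B d C M)
  then show ?case using height_compose by fastforce
next
  case (fun_cast V W c A\<^sub>1 A\<^sub>2 B\<^sub>1 B\<^sub>2)
  then show ?case using height_dom_cod by fastforce
next
  case (fst_cast V c A\<^sub>1 A\<^sub>2 B\<^sub>1 B\<^sub>2)
  then show ?case using height_fst_snd by fastforce
next
  case (snd_cast V c A\<^sub>1 A\<^sub>2 B\<^sub>1 B\<^sub>2)
  then show ?case using height_fst_snd by fastforce
next
  case (case_cast V c A\<^sub>1 A\<^sub>2 B\<^sub>1 B\<^sub>2 M N)
  then show ?case using height_inl_inr[of c A\<^sub>1 A\<^sub>2 B\<^sub>1 B\<^sub>2] by (auto simp: weaken_def)
next
  case (beta V A M)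
  then show ?case using c_height_subst0 by simp
qed auto

lemma (in cast_height) size_ok_steps:
  assumes "steps K \<Gamma> M M'" "size_ok n False M"
  shows "(\<exists>m. size_ok m False M') \<and> c_height (height K) M' \<le> c_height (height K) M"
  using assms(1) unfolding steps_def
proof (induction rule: rtranclp_induct)
  case base
  then show ?case using assms(2) by blast
next
  case (step N N')
  then show ?case by (meson size_ok_red c_height_red order_trans)
qed

section \<open>Compiled terms and the size comparison\<close>

text \<open>Compilation never puts a cast outermost, so only a variable counts \<open>1\<close>; one
  enclosing cast gives at most \<open>2\<close>, which both flags accept.\<close>

lemma size_ok_compile: "\<exists>n \<le> 1. size_ok n \<beta> (compile coerce \<Gamma> M)"
proof -
  have cast: "\<exists>n. size_ok n \<beta> (Cast M c)" if "\<exists>n \<le> 1. size_ok n \<beta> M" for \<beta> c and M :: "('c, 'd) trm"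
    using that by (metis size_ok_Cast)
  show ?thesis
  proof (induction M arbitrary: \<beta> \<Gamma>)
    case (GVar x)
    show ?case by (auto intro: size_ok_Var)
  next
    case (GLam A M)
    from GLam[of True "A # \<Gamma>"] show ?case by (auto intro: size_ok.intros)
  next
    case (GApp l L M)
    show ?case
      by (auto simp: Let_def split: prod.split)
        (meson cast[OF GApp.IH(1)] cast[OF GApp.IH(2)] size_ok.intros(9) zero_le)
  next
    case (GIf l L M N)
    show ?case unfolding compile.simps Let_def
      by (meson cast[OF GIf.IH(1)] cast[OF GIf.IH(2)] cast[OF GIf.IH(3)] size_ok.intros(7) zero_le)
  next
    case (GCons M N)
    from GCons[of \<beta> \<Gamma>] show ?case by (auto intro: size_ok.intros)
  next
    case (GFst l M)
    show ?case
      by (auto simp: Let_def split: prod.split) (meson cast[OF GFst.IH] size_ok.intros(11) zero_le)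
  next
    case (GSnd l M)
    show ?case
      by (auto simp: Let_def split: prod.split) (meson cast[OF GSnd.IH] size_ok.intros(12) zero_le)
  next
    case (GInl B M)
    from GInl[of \<beta> \<Gamma>] show ?case by (auto intro: size_ok.intros)
  next
    case (GInr A M)
    from GInr[of \<beta> \<Gamma>] show ?case by (auto intro: size_ok.intros)
  next
    case (GCase l B C L M N)
    show ?case unfolding compile.simps Let_def
      by (meson cast[OF GCase.IH(1)] cast[OF GCase.IH(2)] cast[OF GCase.IH(3)]
          size_ok.intros(6,8) zero_le)
  qed (auto intro: size_ok.intros)
qed

text \<open>Each node other than a cast pays \<open>3 * d\<close> for the at most three casts
  stacked on it.\<close>

lemma real_size_bound:
  assumes "\<And>c. h c \<le> b \<Longrightarrow> s c \<le> d" "size_ok n \<beta> M" "c_height h M \<le> b"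
  shows "real_size s M \<le> (1 + 3 * d) * ideal_size M"
proof -
  let ?r = "real_size s" and ?i = "\<lambda>M. (1 + 3 * d) * ideal_size M"
  \<comment> \<open>A term of count \<open>n\<close> holds credit for \<open>3 - n\<close> further
    casts of size \<open>d\<close>, which the cast rules spend. The second conjunct is what the
    other constructors use of their subterms.\<close>
  have "?r M + 3 * d \<le> n * d + ?i M \<and> ?r M \<le> ?i M"
    using assms(2,3)
  proof (induction rule: size_ok.induct)
    case (1 n M c)
    have "n * d \<le> 2 * d" using 1 by simp
    moreover have "s c \<le> d" using 1 assms(1) by simp
    moreover have "?r M + 3 * d \<le> n * d + ?i M" using 1 by simp
    ultimately show ?case
      unfolding real_size.simps ideal_size.simps add_mult_distrib by (intro conjI; linarith)
  next
    case (2 n M c)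
    have "n * d \<le> 1 * d" using 2 by (intro mult_right_mono) simp_all
    moreover have "s c \<le> d" using 2 assms(1) by simp
    moreover have "?r M + 3 * d \<le> n * d + ?i M" using 2 by simp
    ultimately show ?case
      unfolding real_size.simps ideal_size.simps add_mult_distrib by (intro conjI; linarith)
  qed (simp_all add: add_mult_distrib2)
  then show ?thesis by blast
qed

theorem theorem123:
  fixes K :: "('c, 'l) cast_height"
    and coerce :: "ty \<Rightarrow> ty \<Rightarrow> 'l \<Rightarrow> 'c"
    and \<Gamma> :: ctxt and M :: "'l gterm" and A :: ty
  assumes "cast_height K"
    and "\<And>B C l. consistent B C \<Longrightarrow> is_cast K (coerce B C l) B C"
    and "gtyped \<Gamma> M A"
  shows "\<exists>c :: nat. \<forall>M'. typed K \<Gamma> M' A \<longrightarrow> steps K \<Gamma> (compile coerce \<Gamma> M) M' \<longrightarrow>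
    real_size (csize K) M' \<le> c * ideal_size M'"
proof -
  interpret cast_height K by fact
  let ?M = "compile coerce \<Gamma> M"
  let ?b = "c_height (height K) ?M"
  obtain k\<^sub>1 k\<^sub>2 where k: "\<And>c. csize K c + k\<^sub>1 \<le> k\<^sub>2 * 2 ^ height K c" using size_height by blast
  \<comment> \<open>\<open>?b\<close> depends only on the compiled term and bounds the heights in
    all its reducts, so \<open>d\<close> bounds their cast sizes uniformly.\<close>
  define d where "d = k\<^sub>2 * 2 ^ ?b"
  have size: "csize K c \<le> d" if "height K c \<le> ?b" for c
  proof -
    have "k\<^sub>2 * 2 ^ height K c \<le> d" unfolding d_def using that by simp
    with k[of c] show ?thesis by linarith
  qed
  obtain n where "size_ok n False ?M" using size_ok_compile by blast
  then have "real_size (csize K) M' \<le> (1 + 3 * d) * ideal_size M'" if "steps K \<Gamma> ?M M'" for M'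
    using size_ok_steps[OF that] real_size_bound[of "height K" ?b "csize K" d, OF size] by blast
  then show ?thesis by blast
qed

end
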